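(* Let $G$ be a Cayley graph (with respect to a finite generating set) of a finitely generated group of intermediate growth such that, for some $K_1,K_2>0$ and $a,b\in(0,1)$, the cardinality $b_n$ of a ball of radius $n$ satisfies $K_1e^{n^a}\le b_n\le K_2e^{n^b}$ for all $n\ge 1$. Then: (1) there exists $K_3>0$ such that there are infinitely many integers $n$ with $\frac{\mathrm{Sep}_G(n)}{n}\ge \frac{K_3}{(\log n)^{1+\frac1a}}$; (2) there exists $K_4>0$ such that for any integer $n\ge 2$, $\frac{\mathrm{Sep}_G(n)}{n}\le \frac{K_4}{(\log n)^{\frac1b-1}}$.
   Context: A graph $G$ has vertex set $VG$ and edge set $EG\subset VG\times VG$; adjacency is undirected. For $A\subset VG$, $\partial A=\{(a,b)\in EG : \text{exactly one of } a,b \text{ lies in } A\}$. For a finite graph $H$, the Cheeger constant is $h(H)=\min\{|\partial_H A|/|A| : \emptyset\ne A\subset VH,\ |A|\le |VH|/2\}$, where $\partial_H$ is the boundary in $H$. For a finite $F\subset VG$, $h(F)$ is the Cheeger constant of the subgraph of $G$ induced on $F$, with the convention $h(F)=0$ if $|F|\le1$. The separation profile is $\mathrm{Sep}_G(n)=\sup\{|F|\, h(F) : F\subset VG,\ |F|\le n\}$. *)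

theory Defs
  imports
    "HOL-Algebra.Generated_Groups"
    "HOL-Library.Landau_Symbols"
    "Graph_Theory.Graph_Theory"
begin

text \<open>
  An undirected graph is a digraph with a symmetric arc set, so that every edge contributes
  both of its orientations to the boundary: the edge set is a set of ordered pairs.
  Counting unordered edges instead would divide the separation profile by two.
\<close>

definition edge_boundary :: "('a, 'b) pre_digraph \<Rightarrow> 'a set \<Rightarrow> 'b set" where
  "edge_boundary G A = {e \<in> arcs G. (tail G e \<in> A) \<noteq> (head G e \<in> A)}"

text \<open>Only meaningful for finite graphs with at least two vertices: otherwise the minimum
  ranges over an empty or an infinite set.\<close>

definition cheeger :: "('a, 'b) pre_digraph \<Rightarrow> real" where
  "cheeger H = Min {real (card (edge_boundary H A)) / real (card A) | A.
     A \<noteq> {} \<and> A \<subseteq> verts H \<and> real (card A) \<le> real (card (verts H)) / 2}"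

definition induced_cheeger :: "('a, 'b) pre_digraph \<Rightarrow> 'a set \<Rightarrow> real" where
  "induced_cheeger G F = (if card F \<le> 1 then 0 else cheeger (induce_subgraph G F))"

text \<open>The real supremum is a genuine one: the values are bounded, see
  \<open>bdd_above_separation\<close> below.\<close>

definition separation_profile :: "('a, 'b) pre_digraph \<Rightarrow> nat \<Rightarrow> real" where
  "separation_profile G n =
     (SUP F \<in> {F. F \<subseteq> verts G \<and> finite F \<and> card F \<le> n}. real (card F) * induced_cheeger G F)"

definition graph_ball :: "('a, 'b) pre_digraph \<Rightarrow> 'a \<Rightarrow> nat \<Rightarrow> 'a set" where
  "graph_ball G u n = {v. \<exists>p. pre_digraph.awalk G u p v \<and> length p \<le> n}"

definition cayley_graph :: "('a, 'c) monoid_scheme \<Rightarrow> 'a set \<Rightarrow> ('a, 'a \<times> 'a) pre_digraph" where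
  "cayley_graph G S = with_proj
     \<lparr> pverts = carrier G,
       parcs = {(g, g \<otimes>\<^bsub>G\<^esub> s) | g s. g \<in> carrier G \<and> s \<in> S \<union> m_inv G ` S} \<rparr>"

text \<open>Cayley graphs are vertex-transitive, so the choice of the centre is immaterial.\<close>

definition growth :: "('a, 'c) monoid_scheme \<Rightarrow> 'a set \<Rightarrow> nat \<Rightarrow> nat" where
  "growth G S n = card (graph_ball (cayley_graph G S) \<one>\<^bsub>G\<^esub> n)"

definition finite_generating_set :: "('a, 'c) monoid_scheme \<Rightarrow> 'a set \<Rightarrow> bool" where
  "finite_generating_set G S \<longleftrightarrow> finite S \<and> S \<subseteq> carrier G \<and> generate G S = carrier G"

text \<open>Growth that is neither polynomial nor exponential. This does not depend on the finite
  generating set, since two of them give growth functions that dominate each other up to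
  rescaling the radius; hence it is a property of the group.\<close>

definition intermediate_growth :: "('a, 'c) monoid_scheme \<Rightarrow> bool" where
  "intermediate_growth G \<longleftrightarrow> (\<exists>S. finite_generating_set G S \<and>
     \<not> (\<exists>d::nat. (\<lambda>n. real (growth G S n)) \<in> O(\<lambda>n. real n ^ d)) \<and>
     \<not> (\<exists>c::real. c > 1 \<and> (\<lambda>n. c ^ n) \<in> O(\<lambda>n. real (growth G S n))))"

lemma bdd_above_separation:
  "bdd_above ((\<lambda>F. real (card F) * induced_cheeger (cayley_graph G S) F) `
     {F. F \<subseteq> verts (cayley_graph G S) \<and> finite F \<and> card F \<le> n})"
proof (rule bdd_aboveI2)
  fix F assume "F \<in> {F. F \<subseteq> verts (cayley_graph G S) \<and> finite F \<and> card F \<le> n}"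
  then have F: "finite F" "card F \<le> n" by simp_all
  define H where "H = induce_subgraph (cayley_graph G S) F"
  have VH: "verts H = F" by (simp add: H_def)
  have "induced_cheeger (cayley_graph G S) F \<le> real (n * n)"
  proof (cases "card F \<le> 1")
    case False
    then have "F \<noteq> {}" by force
    then obtain x where x: "x \<in> F" by blast
    define f where "f = (\<lambda>A. real (card (edge_boundary H A)) / real (card A))"
    define P where "P = (\<lambda>A. A \<noteq> {} \<and> A \<subseteq> verts H \<and> real (card A) \<le> real (card (verts H)) / 2)"
    have ch: "cheeger H = Min {f A | A. P A}" unfolding cheeger_def f_def P_def by (rule refl)
    have "{f A | A. P A} \<subseteq> f ` Pow F" unfolding P_def VH by blast
    then have fin: "finite {f A | A. P A}" by (rule finite_subset) (simp add: F(1))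
    have "P {x}" unfolding P_def VH using x False by simp
    then have "f {x} \<in> {f A | A. P A}" by blast
    then have "cheeger H \<le> f {x}" unfolding ch by (rule Min_le[OF fin])
    also have "f {x} = real (card (edge_boundary H {x}))" by (simp add: f_def)
    also have "card (edge_boundary H {x}) \<le> card (F \<times> F)"
    proof (rule card_mono)
      show "edge_boundary H {x} \<subseteq> F \<times> F"
        unfolding edge_boundary_def H_def cayley_graph_def by (simp add: subset_iff)
    qed (simp add: F(1))
    also have "card (F \<times> F) \<le> n * n"
      unfolding card_cartesian_product by (rule mult_le_mono[OF F(2) F(2)])
    finally show ?thesis using False by (simp add: induced_cheeger_def H_def)
  qed (simp add: induced_cheeger_def)
  then have "real (card F) * induced_cheeger (cayley_graph G S) F \<le> real (card F) * real (n * n)"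
    by (rule mult_left_mono) simp
  also have "\<dots> \<le> real n * real (n * n)"
    using F(2) by (intro mult_right_mono) simp_all
  finally show "real (card F) * induced_cheeger (cayley_graph G S) F \<le> real n * real (n * n)" .
qed

end

theory Submission
  imports Defs "HOL-Real_Asymp.Real_Asymp"
begin

text \<open>
  Upper bound: let \<open>F\<close> be a set of \<open>m\<close> vertices and cut it along balls. The balls
  of radius up to \<open>R \<approx> (ln m / 2) powr (1 / b)\<close> have at most \<open>m / 2\<close> elements, and since
  their traces on \<open>F\<close> grow from \<open>1\<close> to at most \<open>m\<close>, some step multiplies the size by at most
  \<open>1 + 2 ln m / R\<close>. The trace before this step has boundary in \<open>F\<close> of relative size
  \<open>O(ln m / R)\<close>.

  Lower bound: let \<open>\<Lambda> n\<close> be the minimum of \<open>|\<partial>A| / |A|\<close> over nonempty sets of at most \<open>n\<close>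
  vertices. If \<open>F\<close> attains \<open>\<Lambda> (2 n)\<close>, then splitting \<open>F\<close> into \<open>A\<close> and \<open>F - A\<close>
  shows that its Cheeger constant is at least \<open>(\<Lambda> n - \<Lambda> (2 n)) / 2\<close>. Subexponential growth makes
  \<open>\<Lambda>\<close> tend to \<open>0\<close>, while the argument of Coulhon and Saloff-Coste gives
  \<open>\<Lambda> (2 ^ k) \<ge> c * k powr (- 1 / a)\<close>. Hence the drops \<open>\<Lambda> (2 ^ k) - \<Lambda> (2 ^ (k + 1))\<close> cannot
  eventually all be smaller than a small multiple of \<open>k powr (- 1 - 1 / a)\<close>.
\<close>

section \<open>Two facts about real sequences: slow steps and large drops\<close>

text \<open>If all \<open>R\<close> steps grew by more than the factor \<open>1 + e\<close>, then
  \<open>f R\<close> would exceed \<open>(1 + e) ^ R\<close>, which is at least \<open>M\<close>.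
  The factor 2 in \<open>len\<close> pays for replacing \<open>1 + e\<close> by the smaller
  \<open>exp (e / 2)\<close>, which is legitimate for \<open>e <= 1\<close>.\<close>

lemma slow_step:
  fixes f :: "nat \<Rightarrow> nat" and e M :: real
  assumes f0: "f 0 \<ge> 1" and fR: "real (f R) \<le> M" and R: "R > 0" and M: "M > 0"
    and e: "0 < e" "e \<le> 1" and len: "2 * ln M \<le> e * real R"
  obtains r where "r < R" "real (f (Suc r)) \<le> (1 + e) * real (f r)"
proof -
  have "\<exists>r<R. real (f (Suc r)) \<le> (1 + e) * real (f r)"
  proof (rule ccontr)
    assume "\<not> ?thesis"
    then have step: "(1 + e) * real (f r) < real (f (Suc r))" if "r < R" for r
      using that by (meson not_le)
    have pow: "(1 + e) ^ r \<le> real (f r)" if "r \<le> R" for r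
      using that
    proof (induction r)
      case (Suc r)
      then have "(1 + e) * (1 + e) ^ r \<le> (1 + e) * real (f r)"
        using e by (intro mult_left_mono) auto
      with step[of r] Suc.prems show ?case by simp
    qed (use f0 in simp)
    \<comment> \<open>\<open>pow\<close> is not strict, since it may be an equality at
      \<open>0\<close>; the strict inequality comes from treating the last step separately.\<close>
    obtain r where r: "R = Suc r" using R gr0_implies_Suc by blast
    have "(1 + e) ^ R \<le> (1 + e) * real (f r)"
      unfolding r using pow[of r] r e by simp
    also have "\<dots> < real (f R)" using step[of r] r by simp
    also have "\<dots> \<le> M" by (rule fR)
    also have "M = exp (ln M)" using M by simp
    also have "\<dots> \<le> exp (real R * (e / 2))" using len by (simp add: mult.commute)
    also have "\<dots> = exp (e / 2) ^ R" by (rule exp_of_nat_mult)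
    also have "\<dots> \<le> (1 + e) ^ R"
    proof (rule power_mono)
      have "exp (e / 2) \<le> 1 + e / 2 + (e / 2)\<^sup>2" using e by (intro exp_bound) auto
      also have "(e / 2)\<^sup>2 \<le> e / 2"
        using e mult_right_mono[of e 1 e] by (simp add: power2_eq_square)
      finally show "exp (e / 2) \<le> 1 + e" by simp
    qed simp
    finally show False by simp
  qed
  then show ?thesis using that by blast
qed

text \<open>Convexity of \<open>x powr (- q)\<close>: the decrease over a unit interval is at least
  the absolute slope at its right end. After division by \<open>(x + 1) powr (- q)\<close> this
  follows from \<open>1 + t <= exp t\<close>.\<close>

lemma inverse_powr_telescope:
  fixes q x :: real
  assumes q: "q > 0" and x: "x > 0"
  shows "q * (x + 1) powr (- (1 + q)) \<le> x powr (- q) - (x + 1) powr (- q)"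
proof -
  have "ln (x / (x + 1)) \<le> x / (x + 1) - 1" using x by (intro ln_le_minus_one) auto
  also have "x / (x + 1) - 1 = - 1 / (x + 1)" using x by (simp add: field_simps)
  finally have l: "1 / (x + 1) \<le> - ln (x / (x + 1))" by simp
  have "1 + q * (1 / (x + 1)) \<le> 1 + q * (- ln (x / (x + 1)))"
    using l q by (intro add_left_mono mult_left_mono) auto
  also have "\<dots> \<le> exp (q * (- ln (x / (x + 1))))" by (rule exp_ge_add_one_self)
  also have "\<dots> = (x / (x + 1)) powr (- q)" using x by (simp add: powr_def)
  also have "\<dots> = x powr (- q) / (x + 1) powr (- q)" using x by (simp add: powr_divide)
  finally have "(1 + q * (1 / (x + 1))) * (x + 1) powr (- q) \<le> x powr (- q)"
    using x by (simp add: field_simps)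
  moreover have "- (1 + q) = - q - 1" by simp
  then have "(x + 1) powr (- (1 + q)) = (x + 1) powr (- q) / (x + 1)"
    using x by (simp only: powr_diff) simp
  ultimately show ?thesis by (simp add: algebra_simps)
qed

text \<open>A null sequence is at each index the sum of its later drops. If these were eventually
  all small, telescoping would give \<open>l k <= c / 2 * real k powr (- q)\<close>, only half of
  the lower bound.\<close>

lemma infinitely_many_large_drops:
  fixes l :: "nat \<Rightarrow> real" and c q :: real
  assumes q: "q > 0" and c: "c > 0" and lim: "l \<longlonglongrightarrow> 0"
    and lower: "\<And>k. k \<ge> k0 \<Longrightarrow> c * real k powr (- q) \<le> l k"
  shows "\<exists>\<^sub>\<infinity>k. c * q / 2 * real (Suc k) powr (- (1 + q)) \<le> l k - l (Suc k)"
proof (rule ccontr)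
  assume "\<not> ?thesis"
  then obtain k1 where k1: "\<And>k. k \<ge> k1 \<Longrightarrow> l k - l (Suc k) < c * q / 2 * real (Suc k) powr (- (1 + q))"
    unfolding INFM_nat_le by (meson not_le)
  \<comment> \<open>The \<open>1\<close> avoids the default value
    \<open>0 powr (- q) = 0\<close>.\<close>
  define k2 where "k2 = max 1 (max k0 k1)"
  \<comment> \<open>The correction term turns the small drops into monotonicity, so \<open>u\<close> increases to its limit \<open>0\<close>.\<close>
  define u where "u k = l k - c / 2 * real k powr (- q)" for k
  have "u k \<le> u (Suc k)" if "k \<ge> k2" for k
  proof -
    have "l k - l (Suc k) \<le> c / 2 * (q * (real k + 1) powr (- (1 + q)))"
      using k1[of k] that by (simp add: k2_def add.commute)
    also have "\<dots> \<le> c / 2 * (real k powr (- q) - (real k + 1) powr (- q))"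
      using c q that by (intro mult_left_mono inverse_powr_telescope) (auto simp: k2_def)
    finally show ?thesis by (simp add: u_def algebra_simps)
  qed
  then have "incseq (\<lambda>k. u (k + k2))" by (intro incseq_SucI) auto
  moreover have "(\<lambda>k. real k powr (- q)) \<longlonglongrightarrow> 0" using q by real_asymp
  then have "u \<longlonglongrightarrow> 0 - c / 2 * 0" unfolding u_def by (intro tendsto_intros lim)
  then have "(\<lambda>k. u (k + k2)) \<longlonglongrightarrow> 0" by (intro LIMSEQ_ignore_initial_segment) simp
  ultimately have "u (0 + k2) \<le> 0" by (rule incseq_le)
  moreover have "c * real k2 powr (- q) > 0" using c by (simp add: k2_def)
  moreover have "c * real k2 powr (- q) \<le> l k2" by (rule lower) (simp add: k2_def)
  ultimately show False by (simp add: u_def)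
qed

section \<open>Cayley graphs\<close>

locale cayley = group G for G :: "('a, 'c) monoid_scheme" (structure) +
  fixes S :: "'a set"
  assumes fin_S: "finite S" and S_sub: "S \<subseteq> carrier G"
begin

abbreviation X :: "('a, 'a \<times> 'a) pre_digraph" where "X \<equiv> cayley_graph G S"

definition T :: "'a set" where "T = S \<union> m_inv G ` S"

lemma fin_T: "finite T" using fin_S by (simp add: T_def)

lemma T_closed: "s \<in> T \<Longrightarrow> s \<in> carrier G" using S_sub by (auto simp: T_def)

lemma T_inv: "s \<in> T \<Longrightarrow> inv s \<in> T" using S_sub by (auto simp: T_def)

lemma verts_X [simp]: "verts X = carrier G"
  and tail_X [simp]: "tail X = fst"
  and head_X [simp]: "head X = snd"
  by (simp_all add: cayley_graph_def)

lemma arcs_X: "arcs X = {(g, g \<otimes> s) | g s. g \<in> carrier G \<and> s \<in> T}"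
  by (simp add: cayley_graph_def T_def)

text \<open>The last equation reads the arc backwards, as a step by \<open>inv s\<close>, which is
  again in \<open>T\<close>.\<close>

lemma arcs_XE:
  assumes "e \<in> arcs X"
  obtains g s where "e = (g, g \<otimes> s)" "g \<in> carrier G" "s \<in> T" "g = (g \<otimes> s) \<otimes> inv s"
proof -
  obtain g s where "e = (g, g \<otimes> s)" "g \<in> carrier G" "s \<in> T" using assms by (auto simp: arcs_X)
  then show ?thesis using that by (simp add: m_assoc T_closed)
qed

lemma wf_X: "wf_digraph X"
  by standard (auto simp: arcs_X T_closed)

abbreviation ball :: "nat \<Rightarrow> 'a set" where "ball n \<equiv> graph_ball X \<one> n"

lemma ball_0: "ball 0 = {\<one>}"
proof -
  interpret wf_digraph X by (rule wf_X)
  show ?thesis by (auto simp: graph_ball_def awalk_Nil_iff)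
qed

text \<open>Splits off the last arc of a walk. From here on balls are handled by this recursion,
  without walks.\<close>

lemma ball_Suc: "ball (Suc n) = ball n \<union> {h \<otimes> s | h s. h \<in> ball n \<and> s \<in> T}"
proof -
  interpret wf_digraph X by (rule wf_X)
  show ?thesis
  proof (intro equalityI subsetI)
    fix v assume "v \<in> ball (Suc n)"
    then obtain p where p: "awalk \<one> p v" "length p \<le> Suc n" by (auto simp: graph_ball_def)
    show "v \<in> ball n \<union> {h \<otimes> s | h s. h \<in> ball n \<and> s \<in> T}"
    proof (cases p rule: rev_cases)
      case Nil
      then show ?thesis using p by (auto simp: graph_ball_def)
    next
      case (snoc q e)
      then have q: "awalk \<one> q (awlast \<one> q)" "awalk (awlast \<one> q) [e] v"
        using p by auto
      then have "awlast \<one> q \<in> ball n" using p snoc by (auto simp: graph_ball_def)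
      moreover have "e \<in> arcs X" "fst e = awlast \<one> q" "snd e = v"
        using q(2) by (auto simp: awalk_Cons_iff awalk_Nil_iff)
      ultimately show ?thesis by (auto simp: arcs_X)
    qed
  next
    fix v assume v: "v \<in> ball n \<union> {h \<otimes> s | h s. h \<in> ball n \<and> s \<in> T}"
    show "v \<in> ball (Suc n)"
    proof (cases "v \<in> ball n")
      case True
      then show ?thesis by (auto simp: graph_ball_def intro: le_SucI)
    next
      case False
      then obtain h s p where *: "v = h \<otimes> s" "s \<in> T" "awalk \<one> p h" "length p \<le> n"
        using v by (auto simp: graph_ball_def)
      then have "h \<in> carrier G" using awalk_last_in_verts by force
      then have "awalk h [(h, v)] v"
        using * by (auto simp: awalk_Cons_iff awalk_Nil_iff arcs_X T_closed)
      then have w: "awalk \<one> (p @ [(h, v)]) v" using * awalk_appendI by blast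
      show ?thesis
        unfolding graph_ball_def by (intro CollectI exI conjI, rule w) (use * in simp)
    qed
  qed
qed

lemma ball_closed: "ball n \<subseteq> carrier G"
  by (induction n) (auto simp: ball_0 ball_Suc T_closed)

lemma ball_Suc_subset: "ball n \<subseteq> ball (Suc n)" by (auto simp: ball_Suc)

lemma ball_mono: "m \<le> n \<Longrightarrow> ball m \<subseteq> ball n"
  using lift_Suc_mono_le[of ball] ball_Suc_subset by blast

lemma finite_ball: "finite (ball n)"
proof (induction n)
  case (Suc n)
  have "{h \<otimes> s | h s. h \<in> ball n \<and> s \<in> T} = (\<lambda>(h, s). h \<otimes> s) ` (ball n \<times> T)" by auto
  then show ?case using Suc fin_T by (simp add: ball_Suc)
qed (simp add: ball_0)

lemma ball_step: "h \<in> ball n \<Longrightarrow> s \<in> T \<Longrightarrow> h \<otimes> s \<in> ball (Suc n)"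
  by (auto simp: ball_Suc)

lemma one_in_ball: "\<one> \<in> ball n" using ball_mono[of 0 n] by (auto simp: ball_0)

lemma growth_card: "growth G S n = card (ball n)" by (simp add: growth_def)

lemma growth_pos: "growth G S n \<ge> 1"
  using one_in_ball[of n] finite_ball[of n]
  by (simp add: growth_card Suc_le_eq card_gt_0_iff) blast

section \<open>Edge boundaries\<close>

text \<open>An arc touching \<open>D\<close> is determined by an endpoint in \<open>D\<close>, its
  direction and a letter of \<open>T\<close>. Arcs into \<open>y\<close> have the form
  \<open>(y \<otimes> s, y)\<close> because \<open>T\<close> is closed under inverses.\<close>

lemma card_touching_arcs:
  assumes D: "finite D" and E: "E \<subseteq> arcs X" "\<And>e. e \<in> E \<Longrightarrow> fst e \<in> D \<or> snd e \<in> D"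
  shows "finite E" "card E \<le> 2 * card T * card D"
proof -
  define P where "P = (\<lambda>(y, s). (y, y \<otimes> s)) ` (D \<times> T)"
  define Q where "Q = (\<lambda>(y, s). (y \<otimes> s, y)) ` (D \<times> T)"
  have sub: "E \<subseteq> P \<union> Q"
  proof
    fix e assume e: "e \<in> E"
    then obtain g s where gs: "e = (g, g \<otimes> s)" "g \<in> carrier G" "s \<in> T" "g = (g \<otimes> s) \<otimes> inv s"
      using E(1) arcs_XE by blast
    then have "g \<otimes> s \<in> D \<Longrightarrow> e \<in> Q" using gs T_inv unfolding Q_def by force
    moreover have "g \<in> D \<Longrightarrow> e \<in> P" using gs unfolding P_def by force
    ultimately show "e \<in> P \<union> Q" using E(2)[OF e] gs by auto
  qed
  have fin: "finite P" "finite Q" using D fin_T by (auto simp: P_def Q_def)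
  then show "finite E" using sub finite_subset by blast
  have "card P \<le> card D * card T" "card Q \<le> card D * card T"
    unfolding P_def Q_def card_cartesian_product[symmetric]
    by (rule card_image_le, use D fin_T in simp)+
  moreover have "card E \<le> card P + card Q"
    using card_mono[OF _ sub] fin card_Un_le[of P Q] by (meson finite_UnI le_trans)
  ultimately show "card E \<le> 2 * card T * card D" by (simp add: algebra_simps)
qed

lemma boundary_X: "edge_boundary X A = {e \<in> arcs X. (fst e \<in> A) \<noteq> (snd e \<in> A)}"
  by (simp add: edge_boundary_def)

lemma boundary_induced:
  "edge_boundary (induce_subgraph X F) A =
     {e \<in> arcs X. fst e \<in> F \<and> snd e \<in> F \<and> (fst e \<in> A) \<noteq> (snd e \<in> A)}"
  by (auto simp: edge_boundary_def)

lemma finite_boundary: "finite A \<Longrightarrow> finite (edge_boundary X A)"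
  by (rule card_touching_arcs(1)[of A]) (auto simp: boundary_X)

lemma card_boundary_le: "finite A \<Longrightarrow> card (edge_boundary X A) \<le> 2 * card T * card A"
  by (rule card_touching_arcs(2)[of A]) (auto simp: boundary_X)

text \<open>Each boundary arc has exactly one endpoint outside \<open>A\<close>. It is a neighbour
  of \<open>A\<close> within \<open>F\<close>, hence lies in the layer
  \<open>A' - A\<close>.\<close>

lemma card_induced_boundary_le_layer:
  assumes A': "finite A'" "A \<subseteq> A'"
    and step: "\<And>y s. y \<in> A \<Longrightarrow> s \<in> T \<Longrightarrow> y \<otimes> s \<in> F \<Longrightarrow> y \<otimes> s \<in> A'"
  shows "real (card (edge_boundary (induce_subgraph X F) A))
    \<le> 2 * real (card T) * (real (card A') - real (card A))"
proof -
  have "card (edge_boundary (induce_subgraph X F) A) \<le> 2 * card T * card (A' - A)"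
  proof (rule card_touching_arcs(2))
    fix e assume "e \<in> edge_boundary (induce_subgraph X F) A"
    then have e: "e \<in> arcs X" "fst e \<in> F" "snd e \<in> F" "(fst e \<in> A) \<noteq> (snd e \<in> A)"
      by (auto simp: boundary_induced)
    obtain g s where gs: "e = (g, g \<otimes> s)" "g \<in> carrier G" "s \<in> T" "g = (g \<otimes> s) \<otimes> inv s"
      using e(1) by (rule arcs_XE)
    have "g \<otimes> s \<in> A \<Longrightarrow> g \<in> A'" using step[of "g \<otimes> s" "inv s"] gs e T_inv by simp
    then show "fst e \<in> A' - A \<or> snd e \<in> A' - A" using gs(1,3) e step[of g s] by auto
  qed (use A' in \<open>auto simp: boundary_induced\<close>)
  then have "real (card (edge_boundary (induce_subgraph X F) A))
    \<le> 2 * real (card T) * real (card (A' - A))"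
    using of_nat_mono by fastforce
  also have "real (card (A' - A)) = real (card A') - real (card A)"
    using A' finite_subset[OF A'(2,1)] by (simp add: card_Diff_subset of_nat_diff card_mono)
  finally show ?thesis .
qed

lemma boundary_induced_subset: "edge_boundary (induce_subgraph X F) A \<subseteq> edge_boundary X A"
  by (auto simp: boundary_induced boundary_X)

section \<open>Cheeger constants of finite sets of vertices\<close>

definition cheeger_ratios :: "'a set \<Rightarrow> real set" where
  "cheeger_ratios F = {real (card (edge_boundary (induce_subgraph X F) A)) / real (card A) | A.
     A \<noteq> {} \<and> A \<subseteq> F \<and> real (card A) \<le> real (card F) / 2}"

lemma induced_cheeger_Min: "card F \<ge> 2 \<Longrightarrow> induced_cheeger X F = Min (cheeger_ratios F)"
  by (simp add: induced_cheeger_def cheeger_def cheeger_ratios_def)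

lemma finite_cheeger_ratios:
  assumes "finite F" shows "finite (cheeger_ratios F)"
proof (rule finite_subset)
  show "cheeger_ratios F \<subseteq>
    (\<lambda>A. real (card (edge_boundary (induce_subgraph X F) A)) / real (card A)) ` Pow F"
    by (auto simp: cheeger_ratios_def)
qed (use assms in simp)

lemma cheeger_le:
  assumes "card F \<ge> 2" "A \<noteq> {}" "A \<subseteq> F" "real (card A) \<le> real (card F) / 2"
  shows "induced_cheeger X F \<le> real (card (edge_boundary (induce_subgraph X F) A)) / real (card A)"
proof -
  have "finite F" using assms(1) card.infinite by fastforce
  then show ?thesis
    unfolding induced_cheeger_Min[OF assms(1)]
    by (intro Min_le finite_cheeger_ratios) (use assms in \<open>auto simp: cheeger_ratios_def\<close>)
qed

text \<open>The minimum is attained, since singletons are admissible once \<open>F\<close> has two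
  elements.\<close>

lemma cheeger_ge:
  assumes F: "card F \<ge> 2"
    and le: "\<And>A. A \<noteq> {} \<Longrightarrow> A \<subseteq> F \<Longrightarrow> real (card A) \<le> real (card F) / 2 \<Longrightarrow>
      t * real (card A) \<le> real (card (edge_boundary (induce_subgraph X F) A))"
  shows "t \<le> induced_cheeger X F"
proof -
  have fin: "finite F" using F card.infinite by fastforce
  obtain x where "x \<in> F" using F by fastforce
  then have "real (card (edge_boundary (induce_subgraph X F) {x})) / real (card {x}) \<in> cheeger_ratios F"
    unfolding cheeger_ratios_def using F by (intro CollectI exI[of _ "{x}"]) auto
  then have "Min (cheeger_ratios F) \<in> cheeger_ratios F"
    by (intro Min_in finite_cheeger_ratios fin) auto
  then obtain A where A: "A \<noteq> {}" "A \<subseteq> F" "real (card A) \<le> real (card F) / 2"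
    "induced_cheeger X F = real (card (edge_boundary (induce_subgraph X F) A)) / real (card A)"
    unfolding induced_cheeger_Min[OF F] by (auto simp: cheeger_ratios_def)
  moreover have "card A > 0" using A fin finite_subset card_gt_0_iff by blast
  ultimately show ?thesis using le[of A] by (simp add: pos_le_divide_eq)
qed

text \<open>Singletons as test sets. This crude bound serves the sets too small for the cut along
  balls.\<close>

lemma cheeger_le_degree:
  assumes "card F \<ge> 2"
  shows "induced_cheeger X F \<le> 2 * real (card T)"
proof -
  obtain x where "x \<in> F" using assms by fastforce
  then have "induced_cheeger X F \<le> real (card (edge_boundary (induce_subgraph X F) {x}))"
    using cheeger_le[OF assms, of "{x}"] assms by simp
  also have "\<dots> \<le> real (card (edge_boundary X {x}))"
    by (intro of_nat_mono card_mono finite_boundary boundary_induced_subset) simp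
  also have "\<dots> \<le> real (2 * card T * card {x})"
    by (intro of_nat_mono card_boundary_le) simp
  finally show ?thesis by simp
qed

section \<open>Cutting along balls\<close>

lemma card_translate:
  assumes "x \<in> carrier G" "B \<subseteq> carrier G"
  shows "card ((\<lambda>g. x \<otimes> g) ` B) = card B"
  by (rule card_image) (use assms in \<open>auto intro!: inj_onI simp: subset_iff\<close>)

text \<open>The test set is the trace on \<open>F\<close> of a ball around a point of
  \<open>F\<close>, taken before a slow step. The bound on \<open>growth G S R\<close> keeps it
  below half of \<open>F\<close>.\<close>

lemma cheeger_le_growth:
  assumes F: "card F \<ge> 2" "F \<subseteq> carrier G"
    and R: "R > 0" "real (growth G S R) \<le> real (card F) / 2"
    and e: "0 < e" "e \<le> 1" "2 * ln (real (card F)) \<le> e * real R"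
  shows "induced_cheeger X F \<le> 2 * real (card T) * e"
proof -
  have fin: "finite F" using F card.infinite by fastforce
  obtain x where x: "x \<in> F" using F by fastforce
  then have xc: "x \<in> carrier G" using F by auto
  \<comment> \<open>Left translation by \<open>x\<close> is a graph automorphism and carries the
    ball around \<open>\<one>\<close> to the ball around \<open>x\<close>.\<close>
  define A where "A r = (\<lambda>g. x \<otimes> g) ` ball r \<inter> F" for r
  have finA: "finite (A r)" for r using fin by (simp add: A_def)
  have xA: "x \<in> A r" for r
    using x xc one_in_ball[of r] by (force simp: A_def)
  have A_mono: "A r \<subseteq> A (Suc r)" for r using ball_Suc_subset[of r] by (auto simp: A_def)
  have A_step: "y \<otimes> s \<in> A (Suc r)" if y: "y \<in> A r" and s: "s \<in> T" and "y \<otimes> s \<in> F" for y s r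
  proof -
    obtain h where h: "h \<in> ball r" "y = x \<otimes> h" using y by (auto simp: A_def)
    then have "y \<otimes> s = x \<otimes> (h \<otimes> s)" using xc s ball_closed T_closed by (auto simp: m_assoc subset_iff)
    then show ?thesis using ball_step[OF h(1) s] that by (auto simp: A_def)
  qed
  have "card (A 0) \<ge> 1" using xA[of 0] finA[of 0] by (simp add: Suc_le_eq card_gt_0_iff) blast
  moreover have "real (card (A R)) \<le> real (card F)"
    using fin by (simp add: A_def card_mono)
  ultimately obtain r where r: "r < R" "real (card (A (Suc r))) \<le> (1 + e) * real (card (A r))"
    using slow_step[of "\<lambda>r. card (A r)" R "real (card F)" e] R e F by auto
  have "card (A r) \<le> card ((\<lambda>g. x \<otimes> g) ` ball r)"
    by (intro card_mono) (auto simp: A_def finite_ball)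
  also have "\<dots> = card (ball r)" by (rule card_translate[OF xc ball_closed])
  also have "\<dots> \<le> card (ball R)" using r by (intro card_mono ball_mono finite_ball) simp
  finally have half: "real (card (A r)) \<le> real (card F) / 2" using R by (simp add: growth_card)
  have "real (card (edge_boundary (induce_subgraph X F) (A r)))
    \<le> 2 * real (card T) * (real (card (A (Suc r))) - real (card (A r)))"
    using A_mono finA A_step by (intro card_induced_boundary_le_layer) auto
  also have "\<dots> \<le> 2 * real (card T) * (e * real (card (A r)))"
    using r by (intro mult_left_mono) (auto simp: algebra_simps)
  finally have "real (card (edge_boundary (induce_subgraph X F) (A r))) / real (card (A r)) \<le> 2 * real (card T) * e"
    using xA[of r] finA[of r] card_gt_0_iff[of "A r"] by (subst pos_divide_le_eq) (auto simp: algebra_simps)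
  moreover have "A r \<noteq> {}" "A r \<subseteq> F" using xA by (auto simp: A_def)
  ultimately show ?thesis using cheeger_le[OF F(1) _ _ half] by linarith
qed

text \<open>The same cut with the whole group in place of \<open>F\<close>: the ball before a slow
  step is a Foelner set.\<close>

lemma small_boundary_ball:
  assumes e: "0 < e" "e \<le> 1" and R: "R > 0" "real (growth G S R) \<le> M" "2 * ln M \<le> e * real R"
  shows "\<exists>r. real (card (edge_boundary X (ball r))) \<le> 2 * real (card T) * e * real (card (ball r))"
proof -
  have "M > 0" using R(2) growth_pos[of R] by linarith
  then obtain r where r: "real (card (ball (Suc r))) \<le> (1 + e) * real (card (ball r))"
    using slow_step[of "growth G S" R M e] growth_pos e R unfolding growth_card by metis
  have "edge_boundary X (ball r) = edge_boundary (induce_subgraph X (carrier G)) (ball r)"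
    using wf_X by (auto simp: boundary_induced boundary_X wf_digraph_def)
  then have "real (card (edge_boundary X (ball r)))
    \<le> 2 * real (card T) * (real (card (ball (Suc r))) - real (card (ball r)))"
    using ball_Suc_subset finite_ball ball_step card_induced_boundary_le_layer by simp
  also have "\<dots> \<le> 2 * real (card T) * (e * real (card (ball r)))"
    using r by (intro mult_left_mono) (auto simp: algebra_simps)
  finally show ?thesis by (auto simp: algebra_simps)
qed

section \<open>The isoperimetric profile\<close>

text \<open>A word of length \<open>n\<close> that moves \<open>x\<close> out of \<open>A\<close> leaves \<open>A\<close> at one of its \<open>n\<close> letters, and
  for a fixed letter the exit arc determines \<open>x\<close>.\<close>

lemma card_moved_le:
  assumes A: "finite A" "A \<subseteq> carrier G" and g: "g \<in> ball n"
  shows "card {x \<in> A. x \<otimes> g \<notin> A} \<le> n * card (edge_boundary X A)"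
  using g
proof (induction n arbitrary: g)
  case 0
  then have "{x \<in> A. x \<otimes> g \<notin> A} = {}" using A by (auto simp: ball_0)
  then show ?case by (simp only:) simp
next
  case (Suc n)
  show ?case
  proof (cases "g \<in> ball n")
    case True
    then show ?thesis using Suc.IH[of g] by simp
  next
    case False
    then obtain h s where hs: "h \<in> ball n" "s \<in> T" "g = h \<otimes> s" using Suc.prems by (auto simp: ball_Suc)
    have c: "h \<in> carrier G" "s \<in> carrier G" using hs ball_closed T_closed by auto
    \<comment> \<open>The points of \<open>?V\<close> leave \<open>A\<close> at the last letter
      \<open>s\<close>; those of \<open>?U\<close> are already outside after
      \<open>h\<close>.\<close>
    let ?U = "{x \<in> A. x \<otimes> h \<notin> A}" and ?V = "{x \<in> A. x \<otimes> h \<in> A \<and> x \<otimes> g \<notin> A}"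
    have "card ?V \<le> card (edge_boundary X A)"
    proof (rule card_inj_on_le)
      show "inj_on (\<lambda>x. (x \<otimes> h, x \<otimes> h \<otimes> s)) ?V"
        using A c by (auto intro!: inj_onI simp: subset_iff)
      show "(\<lambda>x. (x \<otimes> h, x \<otimes> h \<otimes> s)) ` ?V \<subseteq> edge_boundary X A"
      proof
        fix e assume "e \<in> (\<lambda>x. (x \<otimes> h, x \<otimes> h \<otimes> s)) ` ?V"
        then obtain x where x: "x \<in> ?V" "e = (x \<otimes> h, x \<otimes> h \<otimes> s)" by blast
        then have "x \<in> carrier G" using A by auto
        then have xh: "x \<otimes> h \<in> carrier G" "x \<otimes> h \<otimes> s = x \<otimes> g"
          using c hs by (auto simp: m_assoc)
        have "(x \<otimes> h, x \<otimes> h \<otimes> s) \<in> arcs X" using xh(1) hs(2) by (auto simp: arcs_X)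
        then show "e \<in> edge_boundary X A" using x xh(2) by (simp add: boundary_X)
      qed
    qed (use A finite_boundary in simp)
    moreover have "card ?U \<le> n * card (edge_boundary X A)" by (rule Suc.IH[OF hs(1)])
    moreover have "card {x \<in> A. x \<otimes> g \<notin> A} \<le> card (?U \<union> ?V)"
      using A by (intro card_mono) auto
    ultimately show ?thesis using card_Un_le[of ?U ?V] by simp
  qed
qed

text \<open>For each \<open>x \<in> A\<close> at least half of the elements of the ball move \<open>x\<close> out of \<open>A\<close>; double counting
  the pairs \<open>(x, g)\<close> concludes.\<close>

lemma boundary_ge_of_growth:
  assumes A: "finite A" "A \<subseteq> carrier G" and n: "2 * card A \<le> growth G S n"
  shows "card A \<le> 2 * n * card (edge_boundary X A)"
proof -
  let ?E = "card (edge_boundary X A)" and ?B = "ball n"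
  have "card A * card ?B \<le> 2 * (\<Sum>x\<in>A. card {g \<in> ?B. x \<otimes> g \<notin> A})"
  proof -
    have "card ?B \<le> 2 * card {g \<in> ?B. x \<otimes> g \<notin> A}" if "x \<in> A" for x
    proof -
      \<comment> \<open>Left translation by \<open>x\<close> is injective, so at most half of the
        ball can land in \<open>A\<close>.\<close>
      have "card {g \<in> ?B. x \<otimes> g \<in> A} \<le> card A"
        by (rule card_inj_on_le[where f = "\<lambda>g. x \<otimes> g"])
          (use A ball_closed that in \<open>auto intro!: inj_onI simp: subset_iff\<close>)
      moreover have "card ?B = card {g \<in> ?B. x \<otimes> g \<in> A} + card {g \<in> ?B. x \<otimes> g \<notin> A}"
        using finite_ball by (subst card_Un_disjoint[symmetric]) (auto intro: arg_cong[where f = card])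
      ultimately show ?thesis using n by (simp add: growth_card)
    qed
    then have "(\<Sum>x\<in>A. card ?B) \<le> (\<Sum>x\<in>A. 2 * card {g \<in> ?B. x \<otimes> g \<notin> A})" by (intro sum_mono)
    then show ?thesis by (simp add: sum_distrib_left)
  qed
  also have "(\<Sum>x\<in>A. card {g \<in> ?B. x \<otimes> g \<notin> A}) = (\<Sum>g\<in>?B. card {x \<in> A. x \<otimes> g \<notin> A})"
    by (rule sum_multicount_gen) (use A finite_ball in auto)
  also have "\<dots> \<le> (\<Sum>g\<in>?B. n * ?E)" by (intro sum_mono card_moved_le A)
  also have "\<dots> = card ?B * (n * ?E)" by simp
  finally have "card A * card ?B \<le> (2 * n * ?E) * card ?B" by (simp add: algebra_simps)
  then show ?thesis using growth_pos[of n] by (simp add: growth_card)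
qed

definition profile_ratios :: "nat \<Rightarrow> real set" where
  "profile_ratios n = {real (card (edge_boundary X A)) / real (card A) | A.
     A \<noteq> {} \<and> finite A \<and> A \<subseteq> carrier G \<and> card A \<le> n}"

text \<open>The function \<open>\<Lambda>\<close> of the overview.\<close>

definition profile :: "nat \<Rightarrow> real" where "profile n = Min (profile_ratios n)"

text \<open>There may be infinitely many sets \<open>A\<close>, but numerators and denominators of
  their ratios are bounded integers.\<close>

lemma finite_profile_ratios: "finite (profile_ratios n)"
proof (rule finite_subset)
  show "profile_ratios n \<subseteq> (\<lambda>(i, j). real i / real j) ` ({..2 * card T * n} \<times> {..n})"
  proof
    fix t assume "t \<in> profile_ratios n"
    then obtain A where A: "t = real (card (edge_boundary X A)) / real (card A)" "finite A" "card A \<le> n"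
      by (auto simp: profile_ratios_def)
    have "card (edge_boundary X A) \<le> 2 * card T * n"
      using card_boundary_le[OF A(2)] A(3) by (meson le_trans mult_le_mono2)
    then show "t \<in> (\<lambda>(i, j). real i / real j) ` ({..2 * card T * n} \<times> {..n})"
      using A by force
  qed
qed simp

lemma profile_le:
  assumes "finite A" "A \<subseteq> carrier G" "card A \<le> n"
  shows "profile n * real (card A) \<le> real (card (edge_boundary X A))"
proof (cases "A = {}")
  case False
  then have "profile n \<le> real (card (edge_boundary X A)) / real (card A)"
    unfolding profile_def
    by (intro Min_le finite_profile_ratios) (use assms in \<open>auto simp: profile_ratios_def\<close>)
  moreover have "card A > 0" using False assms by (simp add: card_gt_0_iff)
  ultimately show ?thesis by (simp add: field_simps)
qed simp

lemma profile_attained: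
  assumes "n \<ge> 1"
  obtains A where "A \<noteq> {}" "finite A" "A \<subseteq> carrier G" "card A \<le> n"
    "profile n * real (card A) = real (card (edge_boundary X A))"
proof -
  have "real (card (edge_boundary X {\<one>})) / real (card {\<one>}) \<in> profile_ratios n"
    unfolding profile_ratios_def using assms by (intro CollectI exI[of _ "{\<one>}"]) auto
  then have "profile n \<in> profile_ratios n"
    unfolding profile_def by (intro Min_in finite_profile_ratios) auto
  then obtain A where A: "A \<noteq> {}" "finite A" "A \<subseteq> carrier G" "card A \<le> n"
    "profile n = real (card (edge_boundary X A)) / real (card A)"
    by (auto simp: profile_ratios_def)
  then have "card A > 0" by (simp add: card_gt_0_iff)
  then show ?thesis using that A by simp
qed

lemma profile_nonneg: "n \<ge> 1 \<Longrightarrow> profile n \<ge> 0"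
proof -
  assume "n \<ge> 1"
  then obtain A where A: "A \<noteq> {}" "finite A" 
    "profile n * real (card A) = real (card (edge_boundary X A))"
    by (rule profile_attained)
  then have "card A > 0" by (simp add: card_gt_0_iff)
  then show ?thesis using A(3) by (metis of_nat_0_le_iff of_nat_0_less_iff zero_le_mult_iff not_le)
qed

section \<open>From drops of the profile to separation\<close>

text \<open>An arc between \<open>A\<close> and \<open>F - A\<close> lies in both boundaries on the
  left, whence the factor 2. Every other arc there joins \<open>F\<close> to its complement and
  touches only one of the two pieces.\<close>

lemma boundary_split:
  assumes "finite F" "A \<subseteq> F"
  shows "card (edge_boundary X A) + card (edge_boundary X (F - A))
    \<le> card (edge_boundary X F) + 2 * card (edge_boundary (induce_subgraph X F) A)"
proof -
  let ?I = "edge_boundary (induce_subgraph X F) A"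
  let ?P = "edge_boundary X F \<inter> {e. fst e \<in> A \<or> snd e \<in> A}"
  let ?Q = "edge_boundary X F - {e. fst e \<in> A \<or> snd e \<in> A}"
  have fin: "finite (edge_boundary X F)" "finite ?I"
    using assms finite_boundary finite_subset[OF boundary_induced_subset] finite_subset[of A F] by auto
  have "edge_boundary X A \<subseteq> ?I \<union> ?P" "edge_boundary X (F - A) \<subseteq> ?I \<union> ?Q"
    using assms(2) by (auto simp: boundary_X boundary_induced)
  then have "card (edge_boundary X A) \<le> card ?I + card ?P"
    "card (edge_boundary X (F - A)) \<le> card ?I + card ?Q"
    using fin by (meson card_Un_le card_mono finite_Diff finite_Int finite_UnI le_trans)+
  moreover have "card ?P + card ?Q = card (edge_boundary X F)"
    using card_Int_Diff[OF fin(1)] by simp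
  ultimately show ?thesis by simp
qed

text \<open>The better constant \<open>profile n\<close> applies to \<open>A\<close>, since
  \<open>card A <= card F / 2 <= n\<close>; for \<open>F - A\<close> there is
  \<open>profile (2 * n)\<close>. In \<open>boundary_split\<close> the terms
  \<open>profile (2 * n) * card F\<close> cancel by optimality of \<open>F\<close>.\<close>

lemma cheeger_ge_profile_drop:
  assumes F: "finite F" "F \<subseteq> carrier G" "card F \<ge> 2" "card F \<le> 2 * n"
    and opt: "profile (2 * n) * real (card F) = real (card (edge_boundary X F))"
  shows "(profile n - profile (2 * n)) / 2 \<le> induced_cheeger X F"
proof (rule cheeger_ge[OF F(3)])
  fix A assume A: "A \<noteq> {}" "A \<subseteq> F" "real (card A) \<le> real (card F) / 2"
  let ?I = "edge_boundary (induce_subgraph X F) A"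
  have finA: "finite A" using A F finite_subset by blast
  have "profile n * real (card A) \<le> real (card (edge_boundary X A))"
    using A F finA by (intro profile_le) auto
  moreover have "profile (2 * n) * real (card (F - A)) \<le> real (card (edge_boundary X (F - A)))"
    using A F card_mono[of F "F - A"] by (intro profile_le) auto
  moreover have "real (card (F - A)) = real (card F) - real (card A)"
    using A F finA by (simp add: card_Diff_subset of_nat_diff card_mono)
  moreover have "real (card (edge_boundary X A)) + real (card (edge_boundary X (F - A)))
    \<le> real (card (edge_boundary X F)) + 2 * real (card ?I)"
    using boundary_split[OF F(1) A(2)] by linarith
  ultimately show "(profile n - profile (2 * n)) / 2 * real (card A) \<le> real (card ?I)"
    using opt by (simp add: algebra_simps)
qed

lemma separation_ge:
  assumes "finite F" "F \<subseteq> carrier G"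
  shows "real (card F) * induced_cheeger X F \<le> separation_profile X (card F)"
  unfolding separation_profile_def
  by (rule cSUP_upper[OF _ bdd_above_separation]) (use assms in auto)

text \<open>An optimal set for \<open>2 * n\<close> with at most \<open>n\<close> elements would
  also compete for \<open>profile n\<close>, against the strict drop. The resulting bound
  \<open>n < N\<close> is what later provides infinitely many \<open>N\<close>.\<close>

lemma separation_ge_profile_drop:
  assumes n: "n \<ge> 1" and drop: "profile (2 * n) < profile n"
  obtains N where "n < N" "N \<le> 2 * n" "separation_profile X N / real N \<ge> (profile n - profile (2 * n)) / 2"
proof -
  obtain F where F: "F \<noteq> {}" "finite F" "F \<subseteq> carrier G" "card F \<le> 2 * n"
    "profile (2 * n) * real (card F) = real (card (edge_boundary X F))"
    using profile_attained[of "2 * n"] n by auto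
  have pos: "card F > 0" using F by (simp add: card_gt_0_iff)
  have big: "n < card F"
  proof (rule ccontr)
    assume "\<not> n < card F"
    then have "profile n * real (card F) \<le> profile (2 * n) * real (card F)"
      using profile_le[of F n] F by auto
    with drop pos show False by simp
  qed
  have "(profile n - profile (2 * n)) / 2 \<le> induced_cheeger X F"
    using F n big by (intro cheeger_ge_profile_drop) auto
  also have "\<dots> \<le> separation_profile X (card F) / real (card F)"
    using separation_ge[OF F(2,3)] pos by (simp add: field_simps)
  finally show ?thesis using that big F(4) by blast
qed

section \<open>Decay of the profile\<close>

lemma profile_antimono:
  assumes "1 \<le> m" "m \<le> n"
  shows "profile n \<le> profile m"
proof -
  obtain A where A: "A \<noteq> {}" "finite A" "A \<subseteq> carrier G" "card A \<le> m"
    "profile m * real (card A) = real (card (edge_boundary X A))"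
    using profile_attained[OF assms(1)] .
  then have "profile n * real (card A) \<le> profile m * real (card A)"
    using profile_le[of A n] assms by auto
  moreover have "card A > 0" using A by (simp add: card_gt_0_iff)
  ultimately show ?thesis by simp
qed

lemma profile_tendsto_0:
  assumes K: "K > 0" and b: "0 < b" "b < 1"
    and gr: "\<And>n. n \<ge> 1 \<Longrightarrow> real (growth G S n) \<le> K * exp (real n powr b)"
  shows "profile \<longlonglongrightarrow> 0"
proof (rule LIMSEQ_I)
  fix t :: real assume t: "t > 0"
  \<comment> \<open>The \<open>+ 1\<close> keeps the denominator positive and makes the bound
    \<open>et\<close> strict.\<close>
  define e where "e = min 1 (t / (2 * real (card T) + 1))"
  have e: "0 < e" "e \<le> 1" using t by (auto simp: e_def)
  have "2 * real (card T) * e < (2 * real (card T) + 1) * e" using e by simp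
  also have "\<dots> \<le> (2 * real (card T) + 1) * (t / (2 * real (card T) + 1))"
    by (intro mult_left_mono) (auto simp: e_def)
  also have "\<dots> = t" by simp
  finally have et: "2 * real (card T) * e < t" .
  \<comment> \<open>Here \<open>b < 1\<close> enters: the logarithm of the growth is sublinear in
    the radius.\<close>
  have "eventually (\<lambda>R. 2 * (ln K + real R powr b) \<le> e * real R) at_top"
    using e b by real_asymp
  then have "eventually (\<lambda>R. 2 * (ln K + real R powr b) \<le> e * real R \<and> R \<ge> 1) at_top"
    by (intro eventually_conj eventually_ge_at_top)
  then obtain R where R: "2 * (ln K + real R powr b) \<le> e * real R" "R \<ge> 1"
    using eventually_happens trivial_limit_sequentially by blast
  have "2 * ln (K * exp (real R powr b)) \<le> e * real R" using R(1) K by (simp add: ln_mult)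
  then obtain r where r: "real (card (edge_boundary X (ball r))) \<le> 2 * real (card T) * e * real (card (ball r))"
    using small_boundary_ball[OF e _ gr[OF R(2)]] R(2) by auto
  have pos: "card (ball r) \<ge> 1" using growth_pos by (simp add: growth_card)
  have "profile (card (ball r)) * real (card (ball r)) \<le> 2 * real (card T) * e * real (card (ball r))"
    using profile_le[OF finite_ball ball_closed le_refl, of r] r by linarith
  then have "profile (card (ball r)) \<le> 2 * real (card T) * e" using pos by simp
  then have "norm (profile n - 0) < t" if "n \<ge> card (ball r)" for n
    using profile_antimono[OF pos that] profile_nonneg[of n] that pos et by simp
  then show "\<exists>n0. \<forall>n\<ge>n0. norm (profile n - 0) < t" by blast
qed

lemma profile_lower_bound:
  assumes K: "K > 0" and a: "0 < a"
    and gr: "\<And>n. n \<ge> 1 \<Longrightarrow> K * exp (real n powr a) \<le> real (growth G S n)"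
    and k: "k \<ge> 1" "real k \<ge> ln 2 - ln K"
  shows "2 powr (- (1 / a)) / 4 * real k powr (- (1 / a)) \<le> profile (2 ^ k)"
proof -
  \<comment> \<open>Chosen so that the ball of radius \<open>n\<close> has at least
    \<open>2 * 2 ^ k\<close> elements. Of the exponent \<open>2 * k\<close>, one half covers
    \<open>2 ^ k\<close> and the other the constants \<open>ln 2 - ln K\<close>.\<close>
  define y where "y = (2 * real k) powr (1 / a)"
  define n where "n = nat \<lceil>y\<rceil>"
  have y: "y \<ge> 1" unfolding y_def using k a by (intro ge_one_powr_ge_zero) auto
  have n: "y \<le> real n" "real n \<le> y + 1" "n \<ge> 1" using y unfolding n_def by linarith+
  have "y powr a = 2 * real k" using k a by (simp add: y_def powr_powr)
  then have na: "2 * real k \<le> real n powr a" using powr_mono2[of a y "real n"] n y a by simp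
  have "real k * ln 2 \<le> real k * 1" using ln_2_less_1 by (intro mult_left_mono) auto
  then have "ln 2 + real k * ln 2 \<le> ln K + real n powr a" using k na by linarith
  then have "exp (ln 2 + real k * ln 2) \<le> exp (ln K + real n powr a)" by simp
  then have "2 * 2 ^ k \<le> K * exp (real n powr a)" using K by (simp add: exp_add exp_of_nat_mult)
  also have "\<dots> \<le> real (growth G S n)" by (rule gr[OF n(3)])
  finally have big: "2 * 2 ^ k \<le> growth G S n"
    by (metis of_nat_le_iff of_nat_mult of_nat_numeral of_nat_power)
  obtain A where A: "A \<noteq> {}" "finite A" "A \<subseteq> carrier G" "card A \<le> 2 ^ k"
    "profile (2 ^ k) * real (card A) = real (card (edge_boundary X A))"
    using profile_attained[of "2 ^ k"] by auto
  have "card A \<le> 2 * n * card (edge_boundary X A)"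
    using A big by (intro boundary_ge_of_growth) auto
  then have "real (card A) \<le> real (2 * n * card (edge_boundary X A))" by (rule of_nat_mono)
  also have "\<dots> = (2 * real n * profile (2 ^ k)) * real (card A)" using A(5) by simp
  finally have "1 \<le> 2 * real n * profile (2 ^ k)" using A by (simp add: card_gt_0_iff)
  \<comment> \<open>Rounding up costs a factor 2: \<open>n <= y + 1 <= 2 * y\<close>.\<close>
  also have "\<dots> \<le> 4 * y * profile (2 ^ k)"
    using n y profile_nonneg[of "2 ^ k"] by (intro mult_right_mono) auto
  finally have "1 / (4 * y) \<le> profile (2 ^ k)" using y by (simp add: field_simps)
  moreover have "1 / (4 * y) = 2 powr (- (1 / a)) / 4 * real k powr (- (1 / a))"
    by (simp add: y_def powr_minus powr_mult field_simps)
  ultimately show ?thesis by simp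
qed

section \<open>Bounds for the separation profile\<close>

text \<open>The exponent \<open>1 + 1 / a\<close> is that of the differences of the sequence
  \<open>k powr (- 1 / a)\<close>, where \<open>k\<close> is comparable to the logarithm of
  \<open>2 ^ k\<close>.\<close>

theorem separation_lower_bound:
  assumes "K1 > 0" "K2 > 0" "0 < a" "0 < b" "b < 1"
    and "\<And>n. n \<ge> 1 \<Longrightarrow> K1 * exp (real n powr a) \<le> real (growth G S n)"
    and "\<And>n. n \<ge> 1 \<Longrightarrow> real (growth G S n) \<le> K2 * exp (real n powr b)"
  shows "\<exists>K3>0. infinite {n. separation_profile X n / real n \<ge> K3 / (ln (real n)) powr (1 + 1 / a)}"
proof -
  define q where "q = 1 / a"
  define c where "c = 2 powr (- (1 / a)) / (4::real)"
  define d where "d = c * q / 2"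
  \<comment> \<open>Converts \<open>k\<close> to \<open>ln N\<close>: if \<open>k >= 1\<close> and
    \<open>2 ^ k < N\<close>, then \<open>Suc k <= 2 * k <= D * ln N\<close>.\<close>
  define D where "D = 2 / ln (2::real)"
  have pos: "q > 0" "c > 0" "d > 0" "D > 0" using assms by (auto simp: q_def c_def d_def D_def)
  define k0 where "k0 = max 1 (nat \<lceil>ln 2 - ln K1\<rceil>)"
  have "\<exists>\<^sub>\<infinity>k. c * q / 2 * real (Suc k) powr (- (1 + q)) \<le> profile (2 ^ k) - profile (2 ^ Suc k)"
  proof (rule infinitely_many_large_drops[OF pos(1,2)])
    show "(\<lambda>k. profile (2 ^ k)) \<longlonglongrightarrow> 0"
      using LIMSEQ_subseq_LIMSEQ[OF profile_tendsto_0[OF assms(2,4,5,7)], of "\<lambda>k. 2 ^ k"]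
      by (simp add: o_def strict_mono_def)
    show "c * real k powr (- q) \<le> profile (2 ^ k)" if "k \<ge> k0" for k
    proof -
      have "real k \<ge> ln 2 - ln K1" "k \<ge> 1" using that unfolding k0_def by linarith+
      then show ?thesis
        unfolding c_def q_def by (intro profile_lower_bound[OF assms(1,3,6)])
    qed
  qed
  then have drops: "\<exists>k\<ge>m. d * real (Suc k) powr (- (1 + q)) \<le> profile (2 ^ k) - profile (2 ^ Suc k)" for m
    unfolding INFM_nat_le d_def by blast
  \<comment> \<open>The half is lost in passing from a drop to a Cheeger constant.\<close>
  define K3 where "K3 = d / 2 * D powr (- (1 + q))"
  have "\<exists>N>m. separation_profile X N / real N \<ge> K3 / (ln (real N)) powr (1 + q)" for m
  proof -
    obtain k where k: "k \<ge> max 1 m"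
      "d * real (Suc k) powr (- (1 + q)) \<le> profile (2 ^ k) - profile (2 ^ Suc k)"
      using drops by blast
    have "0 < d * real (Suc k) powr (- (1 + q))" using pos by simp
    then have "profile (2 * 2 ^ k) < profile (2 ^ k)" using k by simp
    then obtain N where N: "2 ^ k < N"
      "separation_profile X N / real N \<ge> (profile (2 ^ k) - profile (2 * 2 ^ k)) / 2"
      using separation_ge_profile_drop[of "2 ^ k"] by auto
    have "m < N" using k N less_exp[of k] by linarith
    have "real (2 ^ k) \<le> real N" using N(1) by (intro of_nat_mono) simp
    then have "ln (2 ^ k) \<le> ln (real N)" using N(1) by (subst ln_le_cancel_iff) auto
    then have lnN: "real k * ln 2 \<le> ln (real N)" by (simp add: ln_realpow)
    have "real (Suc k) \<le> D * (real k * ln 2)" using k by (simp add: D_def)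
    also have "\<dots> \<le> D * ln (real N)" using lnN pos by (intro mult_left_mono) auto
    finally have kN: "real (Suc k) \<le> D * ln (real N)" .
    have "0 < D * ln (real N)" using kN by linarith
    then have lnpos: "ln (real N) > 0" using pos by (simp add: zero_less_mult_iff)
    have "K3 / (ln (real N)) powr (1 + q) = d / 2 * (D * ln (real N)) powr (- (1 + q))"
      using pos lnpos by (simp add: K3_def powr_mult powr_minus_divide del: minus_add_distrib)
    also have "\<dots> \<le> d / 2 * real (Suc k) powr (- (1 + q))"
      using pos kN by (intro mult_left_mono powr_mono2') auto
    also have "\<dots> \<le> (profile (2 ^ k) - profile (2 * 2 ^ k)) / 2" using k by simp
    also have "\<dots> \<le> separation_profile X N / real N" by (rule N)
    finally show ?thesis using \<open>m < N\<close> by blast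
  qed
  then have "infinite {n. separation_profile X n / real n \<ge> K3 / (ln (real n)) powr (1 + q)}"
    unfolding infinite_nat_iff_unbounded by simp
  moreover have "K3 > 0" using pos by (simp add: K3_def)
  ultimately show ?thesis unfolding q_def by blast
qed

lemma cheeger_upper_bound:
  assumes K: "K > 0" and b: "0 < b" "b < 1"
    and gr: "\<And>n. n \<ge> 1 \<Longrightarrow> real (growth G S n) \<le> K * exp (real n powr b)"
  obtains C where "C \<ge> 0"
    "\<And>F. F \<subseteq> carrier G \<Longrightarrow> card F \<ge> 2 \<Longrightarrow>
      induced_cheeger X F \<le> C * ln (real (card F)) powr (- (1 / b - 1))"
proof -
  define p where "p = 1 / b"
  have p: "p > 1" using b by (simp add: p_def)
  \<comment> \<open>With \<open>L = ln (card F)\<close>, a ball of this radius has at most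
    \<open>K * exp (L / 2)\<close> elements, that is \<open>K\<close> times the square root of
    \<open>card F\<close>.\<close>
  define y where "y L = (L / 2) powr p" for L :: real
  \<comment> \<open>In turn: rounding \<open>y L\<close> down loses at most half, the ratio
    \<open>e\<close> is at most 1, and the ball fills at most half of \<open>F\<close>.\<close>
  have "eventually (\<lambda>L. 2 \<le> (L / 2) powr p \<and> 4 * L / (L / 2) powr p \<le> 1 \<and> ln (2 * K) \<le> L / 2 \<and> 0 < L) at_top"
    using p by (intro eventually_conj; real_asymp)
  then obtain L0 where L0: "\<And>L. L \<ge> L0 \<Longrightarrow> 2 \<le> y L \<and> 4 * L / y L \<le> 1 \<and> ln (2 * K) \<le> L / 2 \<and> 0 < L"
    unfolding eventually_at_top_linorder y_def by blast
  \<comment> \<open>The first entry of the maximum comes from \<open>e\<close>, the second covers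
    the sets with \<open>L < L0\<close>.\<close>
  define C where "C = 2 * real (card T) * max (4 * 2 powr p) (L0 powr (p - 1))"
  have "induced_cheeger X F \<le> C * ln (real (card F)) powr (- (p - 1))"
    if F: "F \<subseteq> carrier G" "card F \<ge> 2" for F
  proof -
    define L where "L = ln (real (card F))"
    have L: "L > 0" using F by (simp add: L_def)
    \<comment> \<open>The witness is \<open>e\<close> for large sets and \<open>1\<close> for small
      ones.\<close>
    have "\<exists>v. induced_cheeger X F \<le> 2 * real (card T) * v
        \<and> v \<le> max (4 * 2 powr p) (L0 powr (p - 1)) * L powr (- (p - 1))"
    proof (cases "L \<ge> L0")
      case True
      note * = L0[OF True]
      define R where "R = nat \<lfloor>y L\<rfloor>"
      have R: "real R \<le> y L" "y L / 2 \<le> real R" "R > 0" "R \<ge> 1" using * unfolding R_def by linarith+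
      have "real R powr b \<le> y L powr b" using R b by (intro powr_mono2) auto
      also have "\<dots> = L / 2" using L b by (simp add: y_def p_def powr_powr)
      finally have "ln (2 * K) + real R powr b \<le> L" using * by linarith
      then have "exp (ln (2 * K) + real R powr b) \<le> exp L" by simp
      then have "2 * (K * exp (real R powr b)) \<le> real (card F)"
        using K F by (simp add: exp_add L_def)
      then have half: "real (growth G S R) \<le> real (card F) / 2" using gr[OF R(4)] by linarith
      define e where "e = 4 * L / y L"
      have e: "0 < e" "e \<le> 1" using * by (auto simp: e_def)
      have "2 * L = e * (y L / 2)" using * by (simp add: e_def)
      also have "\<dots> \<le> e * real R" using R e by (intro mult_left_mono) auto
      finally have "induced_cheeger X F \<le> 2 * real (card T) * e"
        using F R half e by (intro cheeger_le_growth) (auto simp: L_def)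
      moreover have "e = 4 * 2 powr p * L powr (- (p - 1))"
      proof -
        have "L powr (- (p - 1)) = L / L powr p" using L powr_diff[of L 1 p] by simp
        then show ?thesis using L by (simp add: e_def y_def powr_divide)
      qed
      moreover have "4 * 2 powr p * L powr (- (p - 1))
          \<le> max (4 * 2 powr p) (L0 powr (p - 1)) * L powr (- (p - 1))"
        by (intro mult_right_mono) auto
      ultimately show ?thesis by metis
    next
      case False
      have "1 = L powr (p - 1) * L powr (- (p - 1))" using L by (simp add: powr_add[symmetric])
      also have "\<dots> \<le> L0 powr (p - 1) * L powr (- (p - 1))"
        using False L p by (intro mult_right_mono powr_mono2) auto
      also have "\<dots> \<le> max (4 * 2 powr p) (L0 powr (p - 1)) * L powr (- (p - 1))"
        by (intro mult_right_mono) auto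
      finally show ?thesis using cheeger_le_degree[OF F(2)] by (intro exI[of _ 1]) simp
    qed
    then obtain v where v: "induced_cheeger X F \<le> 2 * real (card T) * v"
      "v \<le> max (4 * 2 powr p) (L0 powr (p - 1)) * L powr (- (p - 1))" by blast
    have "2 * real (card T) * v \<le> 2 * real (card T) * (max (4 * 2 powr p) (L0 powr (p - 1)) * L powr (- (p - 1)))"
      using v(2) by (intro mult_left_mono) auto
    with v(1) show ?thesis unfolding C_def L_def by (simp only: mult.assoc)
  qed
  moreover have "C \<ge> 0" unfolding C_def by (intro mult_nonneg_nonneg) (auto simp: le_max_iff_disj)
  ultimately show ?thesis using that unfolding p_def by blast
qed

text \<open>The bound for a single \<open>F\<close> involves \<open>ln (card F)\<close> instead of
  \<open>ln n\<close>. Above \<open>sqrt n\<close> the two differ at most by a factor 2; below it,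
  the factor \<open>card F\<close> is so small that the degree bound suffices.\<close>

theorem separation_upper_bound:
  assumes K: "K > 0" and b: "0 < b" "b < 1"
    and gr: "\<And>n. n \<ge> 1 \<Longrightarrow> real (growth G S n) \<le> K * exp (real n powr b)"
  shows "\<exists>K4>0. \<forall>n\<ge>2. separation_profile X n / real n \<le> K4 / (ln (real n)) powr (1 / b - 1)"
proof -
  define p where "p = 1 / b - 1"
  have p: "p > 0" using b by (simp add: p_def)
  obtain C where C: "C \<ge> 0" "\<And>F. F \<subseteq> carrier G \<Longrightarrow> card F \<ge> 2 \<Longrightarrow>
      induced_cheeger X F \<le> C * ln (real (card F)) powr (- p)"
    using cheeger_upper_bound[OF assms] unfolding p_def by blast
  define K1 where "K1 = C * 2 powr p"
  define K2 where "K2 = 2 * real (card T) * (2 * p) powr p"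
  define K4 where "K4 = max 1 (max K1 K2)"
  have K4: "K4 > 0" "K1 \<le> K4" "K2 \<le> K4" by (auto simp: K4_def)
  have "separation_profile X n / real n \<le> K4 / (ln (real n)) powr p" if n: "n \<ge> 2" for n
  proof -
    define L where "L = ln (real n)"
    have L: "L > 0" using n by (simp add: L_def)
    have "separation_profile X n \<le> real n * (K4 / L powr p)"
      unfolding separation_profile_def
    proof (rule cSUP_least)
      have "{} \<in> {F. F \<subseteq> verts X \<and> finite F \<and> card F \<le> n}" by simp
      then show "{F. F \<subseteq> verts X \<and> finite F \<and> card F \<le> n} \<noteq> {}" by blast
    next
      fix F assume "F \<in> {F. F \<subseteq> verts X \<and> finite F \<and> card F \<le> n}"
      then have F: "F \<subseteq> carrier G" "finite F" "card F \<le> n" by auto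
      consider "card F \<le> 1" | "card F \<ge> 2" "real (card F) \<le> sqrt (real n)"
        | "card F \<ge> 2" "sqrt (real n) < real (card F)" by linarith
      then show "real (card F) * induced_cheeger X F \<le> real n * (K4 / L powr p)"
      proof cases
        case 1
        then show ?thesis using K4 by (simp add: induced_cheeger_def)
      next
        case 2
        \<comment> \<open>The exponent \<open>1 / (2 * p)\<close> becomes that of a square root
          after raising to the power \<open>p\<close>.\<close>
        have "L \<le> 2 * p * real n powr (1 / (2 * p))"
          using ln_powr_bound[of "real n" "1 / (2 * p)"] n p by (simp add: L_def mult.commute)
        then have "L powr p \<le> (2 * p * real n powr (1 / (2 * p))) powr p"
          using L p by (intro powr_mono2) auto
        also have "\<dots> = (2 * p) powr p * sqrt (real n)"
          using p by (simp add: powr_mult powr_powr powr_half_sqrt)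
        finally have Lp: "L powr p \<le> (2 * p) powr p * sqrt (real n)" .
        have "real (card F) * induced_cheeger X F \<le> sqrt (real n) * (2 * real (card T))"
          using 2 cheeger_le_degree[OF 2(1)]
          by (meson mult_left_mono mult_right_mono of_nat_0_le_iff order_trans mult_nonneg_nonneg zero_le_numeral)
        also have "\<dots> \<le> real n * (K2 / L powr p)"
        proof -
          have "sqrt (real n) * (2 * real (card T)) * L powr p
              \<le> sqrt (real n) * (2 * real (card T)) * ((2 * p) powr p * sqrt (real n))"
            using Lp by (intro mult_left_mono) auto
          also have "\<dots> = (sqrt (real n) * sqrt (real n)) * K2" by (simp add: K2_def)
          finally show ?thesis using L by (simp add: pos_le_divide_eq)
        qed
        also have "\<dots> \<le> real n * (K4 / L powr p)"
          using K4 by (intro mult_left_mono divide_right_mono) auto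
        finally show ?thesis .
      next
        case 3
        have "ln (sqrt (real n)) \<le> ln (real (card F))" using 3 n by (subst ln_le_cancel_iff) auto
        then have lnF: "L / 2 \<le> ln (real (card F))" using n by (simp add: L_def ln_sqrt)
        have "induced_cheeger X F \<le> C * ln (real (card F)) powr (- p)" by (rule C(2)[OF F(1) 3(1)])
        also have "\<dots> \<le> C * (L / 2) powr (- p)"
          using C(1) L lnF p by (intro mult_left_mono powr_mono2') auto
        also have "\<dots> = K1 / L powr p" using L by (simp add: K1_def powr_minus_divide powr_divide)
        also have "\<dots> \<le> K4 / L powr p" using K4 by (intro divide_right_mono) auto
        finally have "real (card F) * induced_cheeger X F \<le> real (card F) * (K4 / L powr p)"
          by (intro mult_left_mono) auto
        also have "\<dots> \<le> real n * (K4 / L powr p)"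
          using F K4 by (intro mult_right_mono) auto
        finally show ?thesis .
      qed
    qed
    then show ?thesis using n unfolding L_def[symmetric] by (simp add: pos_divide_le_eq mult.commute)
  qed
  then show ?thesis using K4(1) unfolding p_def by blast
qed

end

theorem theorem1p5:
  fixes \<Gamma> :: "('a, 'c) monoid_scheme" and S :: "'a set" and a b K1 K2 :: real
  assumes "group \<Gamma>"
    and "finite_generating_set \<Gamma> S"
    and "intermediate_growth \<Gamma>"
    and "K1 > 0" and "K2 > 0"
    and "0 < a" and "a < 1" and "0 < b" and "b < 1"
    and "\<And>n::nat. n \<ge> 1 \<Longrightarrow> K1 * exp (real n powr a) \<le> real (growth \<Gamma> S n)"
    and "\<And>n::nat. n \<ge> 1 \<Longrightarrow> real (growth \<Gamma> S n) \<le> K2 * exp (real n powr b)"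
  shows "(\<exists>K3::real. K3 > 0 \<and>
            infinite {n::nat. separation_profile (cayley_graph \<Gamma> S) n / real n
                                \<ge> K3 / (ln (real n)) powr (1 + 1 / a)})
       \<and> (\<exists>K4::real. K4 > 0 \<and>
            (\<forall>n::nat\<ge>2. separation_profile (cayley_graph \<Gamma> S) n / real n
                          \<le> K4 / (ln (real n)) powr (1 / b - 1)))"
proof -
  interpret group \<Gamma> by (rule assms(1))
  interpret cayley \<Gamma> S using assms(2) by unfold_locales (auto simp: finite_generating_set_def)
  show ?thesis
    using separation_lower_bound[OF assms(4,5,6,8,9,10,11)] separation_upper_bound[OF assms(5,8,9,11)]
    by blast
qed

end
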